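(* Let $n\in\mathbb{N}$, and let $\mathbf{N}$ be a random variable taking values in the odd positive integers. Suppose there exist an absolute constant $c_0>0$ and a natural number $n'\ge(2+c_0)n$ such that $$d_{\mathrm{TV}}\big(\mathbf{N}\bmod 2^{n'},\ \mathbf{Unif}((2\mathbb{Z}+1)/2^{n'}\mathbb{Z})\big)\ll 2^{-n'}.$$ Then $$d_{\mathrm{TV}}\big(\vec a^{(n)}(\mathbf{N}),\ \mathbf{Geom}(2)^n\big)\ll 2^{-c_1n}$$ for some constant $c_1>0$ depending only on $c_0$, where the implied constant in the conclusion depends only on $c_0$ (and on the implied constant in the hypothesis).
   Context: $\mathbb{N}=\{0,1,2,\dots\}$. $X\ll Y$ means $|X|\le CY$ for a constant $C$ (with dependence as indicated). For random variables $\mathbf{X},\mathbf{Y}$ in a common discrete space $R$, $d_{\mathrm{TV}}(\mathbf{X},\mathbf{Y}):=\sum_{r\in R}|\mathbb{P}(\mathbf{X}=r)-\mathbb{P}(\mathbf{Y}=r)|$ (no factor $1/2$). $\mathbf{Unif}(R)$ is a uniformly distributed random variable on the finite set $R$; $(2\mathbb{Z}+1)/2^{n'}\mathbb{Z}$ is the set of residue classes mod $2^{n'}$ of odd integers. $\mathbf{Geom}(2)^n$ is a tuple of $n$ independent copies of the geometric variable $\mathbf{Geom}(2)$ on $\{1,2,\dots\}$ with $\mathbb{P}(\mathbf{Geom}(2)=a)=2^{-a}$. The Syracuse map $\mathrm{Syr}$ sends an odd positive integer $N$ to the largest odd divisor of $3N+1$. $\nu_2(M)$ is the exponent of $2$ in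 $M$. The $n$-Syracuse valuation of an odd positive integer $N$ is the tuple of positive integers $\vec a^{(n)}(N):=(\nu_2(3N+1),\nu_2(3\,\mathrm{Syr}(N)+1),\dots,\nu_2(3\,\mathrm{Syr}^{n-1}(N)+1))$. *)

theory Defs
  imports "HOL-Probability.Probability" "HOL-Computational_Algebra.Computational_Algebra"
begin

text \<open>
  Random variables with values in a discrete space are represented by their laws, i.e. by
  elements of \<^typ>\<open>'a pmf\<close>; a function of a random variable is then \<^const>\<open>map_pmf\<close>.
  All quantities below depend only on these laws.
\<close>

text \<open>No factor \<open>1/2\<close>, so the values range over \<open>[0, 2]\<close>.\<close>

definition dTV :: "'a pmf \<Rightarrow> 'a pmf \<Rightarrow> real" where
  "dTV X Y = (\<Sum>\<^sub>\<infinity>r. \<bar>pmf X r - pmf Y r\<bar>)"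

text \<open>The infinite sum always converges, so its junk value never intervenes.\<close>

lemma dTV_summable: "(\<lambda>r. \<bar>pmf X r - pmf Y r\<bar>) summable_on UNIV"
proof -
  have *: "pmf p summable_on UNIV" for p :: "'a pmf"
    using abs_summable_equivalent[of "pmf p" UNIV] pmf_abs_summable[of p UNIV]
    by (auto intro: abs_summable_summable)
  have "(\<lambda>r. pmf X r + pmf Y r) summable_on UNIV"
    by (intro summable_on_add *)
  then show ?thesis
  proof (rule summable_on_comparison_test)
    fix r
    show "\<bar>pmf X r - pmf Y r\<bar> \<le> pmf X r + pmf Y r"
      using pmf_nonneg[of X r] pmf_nonneg[of Y r] by linarith
  qed auto
qed

text \<open>
  The set \<open>(2\<int>+1)/2\<^sup>m\<int>\<close>; a residue class modulo \<open>2\<^sup>m\<close> is represented by its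
  least nonnegative element. For \<open>m = 0\<close> this is the one-element set \<open>{0}\<close>.
\<close>

definition odd_residues :: "nat \<Rightarrow> int set" where
  "odd_residues m = {k mod 2 ^ m | k :: int. odd k}"

lemma finite_odd_residues: "finite (odd_residues m)"
  by (rule finite_subset[of _ "{0..<2 ^ m}"]) (auto simp: odd_residues_def)

lemma odd_residues_nonempty: "odd_residues m \<noteq> {}"
  unfolding odd_residues_def using odd_one by blast

text \<open>
  The library's \<^const>\<open>geometric_pmf\<close> lives on \<open>{0, 1, 2, \<dots>}\<close> and is parametrized by the
  success probability instead of the mean; hence the shift by one and the parameter \<open>1/2\<close>.
\<close>

definition Geom2 :: "nat pmf" where
  "Geom2 = map_pmf Suc (geometric_pmf (1/2))"

lemma pmf_Geom2: "pmf Geom2 a = (if a = 0 then 0 else (1/2) ^ a)"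
proof (cases a)
  case 0
  then show ?thesis
    by (auto simp: Geom2_def pmf_eq_0_set_pmf)
next
  case (Suc b)
  then show ?thesis
    by (simp add: Geom2_def pmf_map_inj')
qed

definition Syr :: "nat \<Rightarrow> nat" where
  "Syr N = Max {d. odd d \<and> d dvd 3 * N + 1}"

definition syracuse_valuation :: "nat \<Rightarrow> nat \<Rightarrow> nat list" where
  "syracuse_valuation n N = map (\<lambda>i. multiplicity 2 (3 * (Syr ^^ i) N + 1)) [0..<n]"

end

theory Submission
  imports Defs "HOL-Number_Theory.Cong"
begin

text \<open>
  If \<open>a\<close> is a tuple of positive integers with sum \<open>s\<close>, the odd \<open>N\<close> with valuation tuple \<open>a\<close> form
  exactly one odd residue class modulo \<open>2 ^ (s + 1)\<close>. When \<open>s < n'\<close>, the law of \<open>N\<close> modulo \<open>2 ^ n'\<close>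
  therefore determines the probability of \<open>a\<close>, and the uniform law gives it the weight \<open>2 ^ (- s)\<close>,
  which is its probability under \<open>Geom(2) ^ n\<close>. The classes of different tuples are disjoint, so
  these tuples contribute at most the total variation distance in the hypothesis. The other tuples
  are controlled by the Chernoff bound for the event that \<open>n\<close> geometric variables of mean \<open>2\<close> have
  a sum of at least \<open>n' \<ge> (2 + c\<^sub>0) n\<close>.
\<close>

section \<open>Valuation tuples and residue classes\<close>

lemma multiplicity_two_power_times_odd:
  fixes K :: nat
  assumes "odd K"
  shows "multiplicity 2 (2 ^ b * K) = b"
  using assms by (intro multiplicity_eqI) auto

text \<open>An odd divisor of \<open>2 ^ b * K\<close> is coprime to \<open>2 ^ b\<close> and so
  divides \<open>K\<close>; the odd number \<open>K\<close> is itself such a divisor.\<close>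

lemma Syr_eqI:
  assumes "3 * N + 1 = 2 ^ b * K" "odd K"
  shows "Syr N = K"
  unfolding Syr_def
proof (rule Max_eqI)
  show "finite {d. odd d \<and> d dvd 3 * N + 1}"
    by (rule finite_subset[of _ "{..3 * N + 1}"]) (auto dest: dvd_imp_le)
next
  fix d assume "d \<in> {d. odd d \<and> d dvd 3 * N + 1}"
  then have "odd d" "d dvd 2 ^ b * K"
    using assms by auto
  then have "d dvd K"
    using coprime_dvd_mult_right_iff[of d "2 ^ b" K] by simp
  then show "d \<le> K"
    using assms(2) by (intro dvd_imp_le) (auto intro: Nat.gr0I)
qed (use assms in auto)

lemma multiplicity_Syr_decompose:
  "3 * N + 1 = 2 ^ multiplicity 2 (3 * N + 1) * Syr N" "odd (Syr N)"
proof -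
  obtain K where K: "3 * N + 1 = 2 ^ multiplicity 2 (3 * N + 1) * K" "odd K"
    using multiplicity_decompose'[of "3 * N + 1" 2] by auto
  with Syr_eqI[OF K] show "3 * N + 1 = 2 ^ multiplicity 2 (3 * N + 1) * Syr N" "odd (Syr N)"
    by simp_all
qed

lemma syracuse_valuation_0: "syracuse_valuation 0 N = []"
  by (simp add: syracuse_valuation_def)

lemma syracuse_valuation_Suc:
  "syracuse_valuation (Suc n) N = multiplicity 2 (3 * N + 1) # syracuse_valuation n (Syr N)"
  unfolding syracuse_valuation_def
  by (simp add: upt_conv_Cons map_Suc_upt[symmetric] funpow_swap1 o_def del: upt_Suc)

lemma cong_power_two_odd_iff:
  fixes x y :: nat
  assumes "[x = y] (mod 2 ^ Suc s)"
  shows "odd x \<longleftrightarrow> odd y"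
  using cong_dvd_iff[OF cong_dvd_modulus_nat[OF assms, of 2]] by simp

lemma cong_mult_modulus_iff:
  fixes c x y m :: nat
  assumes "c > 0"
  shows "[c * x = c * y] (mod c * m) \<longleftrightarrow> [x = y] (mod m)"
  using assms by (simp add: cong_def)

text \<open>Induction from the end of the orbit: the tail of the tuple fixes \<open>Syr N\<close>
  modulo \<open>2 ^ Suc s\<close>, and multiplication by \<open>2 ^ b\<close> turns this into a
  condition on \<open>3 * N + 1\<close> modulo \<open>2 ^ (b + Suc s)\<close>. The extra factor of 2
  in the modulus records that the last iterate is odd.\<close>

lemma syracuse_valuation_fiber:
  assumes "0 \<notin> set a"
  shows "\<exists>r. odd r \<and> (\<forall>N. odd N \<longrightarrow>
    (syracuse_valuation (length a) N = a \<longleftrightarrow> [N = r] (mod 2 ^ Suc (sum_list a))))"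
  using assms
proof (induction a)
  case Nil
  show ?case
    by (rule exI[of _ 1]) (auto simp: syracuse_valuation_0 cong_def odd_iff_mod_2_eq_one)
next
  case (Cons b a)
  define s where "s = sum_list a"
  obtain r where r: "odd r" and fiber: "\<And>N. odd N \<Longrightarrow>
      syracuse_valuation (length a) N = a \<longleftrightarrow> [N = r] (mod 2 ^ Suc s)"
    using Cons unfolding s_def by auto
  have b: "b > 0"
    using Cons.prems by auto
  have "coprime (2 ^ Suc s) (3 :: nat)"
    by (intro coprime_power_left_iff[THEN iffD2] disjI1) (simp add: coprime_iff_gcd_eq_1 gcd_non_0_nat)
  \<comment> \<open>\<open>M\<close> plays the role of \<open>Syr R\<close>. The condition modulo 3
    gives \<open>2 ^ b * M\<close> the residue of \<open>4 ^ b\<close>, which is 1, so that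
    \<open>2 ^ b * M\<close> has the form \<open>3 * R + 1\<close>.\<close>
  then obtain M where M: "[M = r] (mod 2 ^ Suc s)" "[M = 2 ^ b] (mod 3)"
    using binary_chinese_remainder_nat by blast
  have parity: "odd K" if "[K = M] (mod 2 ^ Suc s)" for K
    using cong_power_two_odd_iff[OF cong_trans[OF that M(1)]] r by simp
  have "[2 ^ b * M = 2 ^ b * 2 ^ b] (mod 3)"
    using M(2) by (rule cong_scalar_left)
  also have "2 ^ b * 2 ^ b = (4 :: nat) ^ b"
    by (simp flip: power_mult_distrib)
  also have "[(4 :: nat) ^ b = 1 ^ b] (mod 3)"
    by (intro cong_pow) (simp add: cong_def)
  finally have "(2 ^ b * M) mod 3 = 1"
    by (simp add: cong_def)
  then obtain R where R: "3 * R + 1 = 2 ^ b * M"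
    by (metis mult_div_mod_eq)
  have "even (3 * R + 1)"
    using b unfolding R by simp
  then have "odd R"
    by simp
  moreover have "syracuse_valuation (length (b # a)) N = b # a \<longleftrightarrow>
      [N = R] (mod 2 ^ Suc (sum_list (b # a)))" if "odd N" for N
  proof -
    \<comment> \<open>3 is invertible modulo a power of two.\<close>
    have "[N = R] (mod 2 ^ Suc (sum_list (b # a))) \<longleftrightarrow> [3 * N = 3 * R] (mod 2 ^ (b + Suc s))"
      by (simp add: cong_mult_lcancel_nat s_def del: power_Suc)
    also have "\<dots> \<longleftrightarrow> [3 * N + 1 = 2 ^ b * M] (mod 2 ^ b * 2 ^ Suc s)"
      unfolding R[symmetric] power_add by (simp only: cong_add_rcancel_nat)
    finally have residue: "[N = R] (mod 2 ^ Suc (sum_list (b # a))) \<longleftrightarrow>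
        [3 * N + 1 = 2 ^ b * M] (mod 2 ^ b * 2 ^ Suc s)" .
    show ?thesis
    proof
      assume "syracuse_valuation (length (b # a)) N = b # a"
      then have v: "multiplicity 2 (3 * N + 1) = b" "syracuse_valuation (length a) (Syr N) = a"
        by (auto simp: syracuse_valuation_Suc)
      have "[Syr N = M] (mod 2 ^ Suc s)"
        using fiber[of "Syr N"] v(2) multiplicity_Syr_decompose(2) M(1)
        by (metis cong_sym cong_trans)
      then have "[2 ^ b * Syr N = 2 ^ b * M] (mod 2 ^ b * 2 ^ Suc s)"
        by (intro cong_mult_modulus_iff[THEN iffD2]) simp_all
      then show "[N = R] (mod 2 ^ Suc (sum_list (b # a)))"
        using multiplicity_Syr_decompose(1)[of N] unfolding residue v(1) by simp
    next
      assume "[N = R] (mod 2 ^ Suc (sum_list (b # a)))"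
      then have N: "[3 * N + 1 = 2 ^ b * M] (mod 2 ^ b * 2 ^ Suc s)"
        by (simp only: residue)
      then have "2 ^ b dvd 3 * N + 1"
        using cong_dvd_iff[OF cong_dvd_modulus_nat[OF N, of "2 ^ b"]] by simp
      then obtain K where K: "3 * N + 1 = 2 ^ b * K"
        by (elim dvdE)
      with N have KM: "[K = M] (mod 2 ^ Suc s)"
        by (simp only: cong_mult_modulus_iff zero_less_power zero_less_numeral)
      \<comment> \<open>Oddness of \<open>K\<close> makes \<open>b\<close> the exact valuation of
        \<open>3 * N + 1\<close> and \<open>K\<close> the value \<open>Syr N\<close>.\<close>
      then have "odd K"
        by (rule parity)
      with KM M(1) have "syracuse_valuation (length a) K = a"
        using fiber cong_trans by blast
      then show "syracuse_valuation (length (b # a)) N = b # a"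
        using Syr_eqI[OF K \<open>odd K\<close>] multiplicity_two_power_times_odd[OF \<open>odd K\<close>, of b] K
        by (simp add: syracuse_valuation_Suc)
    qed
  qed
  ultimately show ?case
    by blast
qed

section \<open>Counting odd residues\<close>

lemma card_residue_class_below_power:
  fixes r :: nat
  assumes "t \<le> m"
  shows "card {x. x < 2 ^ m \<and> [x = r] (mod 2 ^ t)} = 2 ^ (m - t)"
proof -
  have "bij_betw (\<lambda>j. r mod 2 ^ t + 2 ^ t * j) {..<2 ^ (m - t)} {x. x < 2 ^ m \<and> [x = r] (mod 2 ^ t)}"
  proof (rule bij_betwI[where g = "\<lambda>x. x div 2 ^ t"])
    have split: "(2 :: nat) ^ m = 2 ^ t * 2 ^ (m - t)"
      using assms by (simp flip: power_add)
    show "(\<lambda>j. r mod 2 ^ t + 2 ^ t * j) \<in> {..<2 ^ (m - t)} \<rightarrow> {x. x < 2 ^ m \<and> [x = r] (mod 2 ^ t)}"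
    proof (intro funcsetI CollectI conjI)
      fix j :: nat assume "j \<in> {..<2 ^ (m - t)}"
      then have "Suc j \<le> 2 ^ (m - t)"
        by simp
      then have "2 ^ t * Suc j \<le> 2 ^ m"
        unfolding split by (rule mult_le_mono2)
      moreover have "r mod 2 ^ t < 2 ^ t"
        by simp
      ultimately show "r mod 2 ^ t + 2 ^ t * j < 2 ^ m"
        unfolding mult_Suc_right by linarith
    qed (simp add: cong_def)
    show "(\<lambda>x. x div 2 ^ t) \<in> {x. x < 2 ^ m \<and> [x = r] (mod 2 ^ t)} \<rightarrow> {..<2 ^ (m - t)}"
      unfolding split by (auto simp: less_mult_imp_div_less mult.commute)
  next
    fix x assume "x \<in> {x. x < 2 ^ m \<and> [x = r] (mod 2 ^ t)}"
    then have "r mod 2 ^ t = x mod 2 ^ t"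
      by (simp add: cong_def)
    then show "r mod 2 ^ t + 2 ^ t * (x div 2 ^ t) = x"
      by simp
  qed simp
  from bij_betw_same_card[OF this] show ?thesis
    by simp
qed

text \<open>Reduction modulo \<open>2 ^ m\<close> preserves parity once the modulus is even; for
  \<open>m = 0\<close> the only residue is 0.\<close>

lemma odd_residues_altdef:
  assumes "m > 0"
  shows "odd_residues m = int ` {x. x < 2 ^ m \<and> odd x}"
proof (intro equalityI subsetI)
  fix y assume "y \<in> odd_residues m"
  then obtain k where k: "y = k mod 2 ^ m" "odd k"
    by (auto simp: odd_residues_def)
  have "odd y"
    using k assms by (simp add: dvd_mod_iff)
  moreover have "0 \<le> y" "y < 2 ^ m"
    using k by simp_all
  ultimately show "y \<in> int ` {x. x < 2 ^ m \<and> odd x}"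
    by (intro image_eqI[of _ _ "nat y"]) (auto simp: nat_less_iff even_nat_iff)
next
  fix y assume "y \<in> int ` {x. x < 2 ^ m \<and> odd x}"
  then obtain x where x: "y = int x" "x < 2 ^ m" "odd x"
    by auto
  then have "int x = int x mod 2 ^ m"
    by simp
  with x show "y \<in> odd_residues m"
    unfolding odd_residues_def by fastforce
qed

lemma card_odd_residues:
  assumes "m > 0"
  shows "card (odd_residues m) = 2 ^ (m - 1)"
  \<comment> \<open>The odd numbers are the class of 1 modulo \<open>2 ^ 1\<close>.\<close>
  using card_residue_class_below_power[of 1 m 1] assms
  by (simp add: odd_residues_altdef card_image cong_def odd_iff_mod_2_eq_one)

text \<open>The tuple is computed on the least nonnegative representative, so \<open>nat\<close>
  loses nothing. Independence of the representative holds for short sums only; see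
  \<open>syracuse_valuation_eq_iff_residue\<close>.\<close>

definition valuation_residues :: "nat \<Rightarrow> nat list \<Rightarrow> int set" where
  "valuation_residues m a = {x \<in> odd_residues m. syracuse_valuation (length a) (nat x) = a}"

lemma card_valuation_residues:
  assumes "0 \<notin> set a" "sum_list a < m"
  shows "card (valuation_residues m a) = 2 ^ (m - Suc (sum_list a))"
proof -
  obtain r where r: "odd r" and fiber: "\<And>N. odd N \<Longrightarrow>
      syracuse_valuation (length a) N = a \<longleftrightarrow> [N = r] (mod 2 ^ Suc (sum_list a))"
    using syracuse_valuation_fiber[OF assms(1)] by auto
  have "odd x" if "[x = r] (mod 2 ^ Suc (sum_list a))" for x
    using cong_power_two_odd_iff[OF that] r by simp
  then have "valuation_residues m a = int ` {x. x < 2 ^ m \<and> [x = r] (mod 2 ^ Suc (sum_list a))}"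
    using assms(2) fiber by (auto simp: valuation_residues_def odd_residues_altdef)
  then show ?thesis
    using card_residue_class_below_power[of "Suc (sum_list a)" m r] assms(2)
    by (simp add: card_image)
qed

text \<open>Since \<open>sum_list a < m\<close>, the modulus \<open>2 ^ Suc (sum_list a)\<close> of
  the fiber divides \<open>2 ^ m\<close>, so reducing \<open>k\<close> modulo \<open>2 ^ m\<close>
  does not move it in or out of the fiber.\<close>

lemma syracuse_valuation_eq_iff_residue:
  assumes "0 \<notin> set a" "sum_list a < m" "odd k"
  shows "syracuse_valuation (length a) k = a \<longleftrightarrow> int k mod 2 ^ m \<in> valuation_residues m a"
proof -
  obtain r where fiber: "\<And>N. odd N \<Longrightarrow>
      syracuse_valuation (length a) N = a \<longleftrightarrow> [N = r] (mod 2 ^ Suc (sum_list a))"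
    using syracuse_valuation_fiber[OF assms(1)] by auto
  have eq: "int k mod 2 ^ m = int (k mod 2 ^ m)"
    by (simp add: zmod_int)
  have "odd (k mod 2 ^ m)"
    using assms by (simp add: dvd_mod_iff)
  moreover have "[k mod 2 ^ m = k] (mod 2 ^ Suc (sum_list a))"
  proof (rule cong_dvd_modulus_nat)
    show "[k mod 2 ^ m = k] (mod 2 ^ m)"
      by (simp add: cong_def)
    show "(2 :: nat) ^ Suc (sum_list a) dvd 2 ^ m"
      using assms(2) by (intro le_imp_power_dvd) simp
  qed
  ultimately have "syracuse_valuation (length a) (k mod 2 ^ m) = a \<longleftrightarrow>
      syracuse_valuation (length a) k = a"
    using assms(3) fiber by (metis cong_sym cong_trans)
  moreover have "int (k mod 2 ^ m) \<in> odd_residues m"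
    unfolding eq[symmetric] odd_residues_def using assms(3) by force
  ultimately show ?thesis
    by (simp add: valuation_residues_def eq)
qed

section \<open>Total variation distance\<close>

lemma pmf_summable_on: "pmf p summable_on A"
  using abs_summable_equivalent[of "pmf p" A] pmf_abs_summable[of p A]
  by (auto intro: abs_summable_summable)

lemma infsum_pmf: "infsum (pmf p) A = measure_pmf.prob p A"
  using infsetsum_infsum[OF pmf_abs_summable[of p A]] by (simp add: measure_pmf_conv_infsetsum)

lemma sum_le_dTV:
  assumes "finite A"
  shows "(\<Sum>r\<in>A. \<bar>pmf p r - pmf q r\<bar>) \<le> dTV p q"
  unfolding dTV_def by (rule finite_sum_le_infsum[OF dTV_summable assms]) auto

text \<open>Both laws have mass 1, so the mass of \<open>p\<close> outside \<open>A\<close> exceeds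
  that of \<open>q\<close> by at most the discrepancy inside \<open>A\<close>. Hence only the tail
  of \<open>q\<close> has to be estimated.\<close>

lemma dTV_le_finite_part:
  assumes "finite A"
  shows "dTV p q \<le> 2 * (\<Sum>r\<in>A. \<bar>pmf p r - pmf q r\<bar>) + 2 * measure_pmf.prob q (- A)"
proof -
  let ?d = "\<lambda>r. \<bar>pmf p r - pmf q r\<bar>"
  have summable: "?d summable_on B" for B
    by (rule summable_on_subset_banach[OF dTV_summable]) simp
  have bound: "?d r \<le> pmf p r + pmf q r" for r
    using pmf_nonneg[of p r] pmf_nonneg[of q r] by linarith
  have "dTV p q = infsum ?d (A \<union> - A)"
    by (simp add: dTV_def)
  also have "\<dots> = (\<Sum>r\<in>A. ?d r) + infsum ?d (- A)"
    using assms by (subst infsum_Un_disjoint) (auto intro: summable)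
  also have "infsum ?d (- A) \<le> (\<Sum>\<^sub>\<infinity>r\<in>- A. pmf p r + pmf q r)"
    by (intro infsum_mono summable summable_on_add pmf_summable_on bound)
  also have "\<dots> = measure_pmf.prob p (- A) + measure_pmf.prob q (- A)"
    by (simp add: infsum_add pmf_summable_on infsum_pmf)
  also have "measure_pmf.prob p (- A) = measure_pmf.prob q (- A) + (\<Sum>r\<in>A. pmf q r - pmf p r)"
    using assms measure_pmf.prob_compl[of A p] measure_pmf.prob_compl[of A q]
    by (simp add: Compl_eq_Diff_UNIV measure_measure_pmf_finite sum_subtractf)
  also have "(\<Sum>r\<in>A. pmf q r - pmf p r) \<le> (\<Sum>r\<in>A. ?d r)"
    by (intro sum_mono) auto
  finally show ?thesis
    by simp
qed

text \<open>Triangle inequality inside each block; as the blocks are disjoint, every point is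
  counted at most once.\<close>

lemma sum_dTV_fibers_le:
  assumes "finite F" "\<And>a. a \<in> F \<Longrightarrow> finite (B a)" "disjoint_family_on B F"
  shows "(\<Sum>a\<in>F. \<bar>measure_pmf.prob p (B a) - measure_pmf.prob q (B a)\<bar>) \<le> dTV p q"
proof -
  have "\<bar>measure_pmf.prob p (B a) - measure_pmf.prob q (B a)\<bar> \<le> (\<Sum>x\<in>B a. \<bar>pmf p x - pmf q x\<bar>)"
    if "a \<in> F" for a
    using assms(2)[OF that] by (simp add: measure_measure_pmf_finite flip: sum_subtractf)
  then have "(\<Sum>a\<in>F. \<bar>measure_pmf.prob p (B a) - measure_pmf.prob q (B a)\<bar>)
      \<le> (\<Sum>a\<in>F. \<Sum>x\<in>B a. \<bar>pmf p x - pmf q x\<bar>)"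
    by (rule sum_mono)
  also have "\<dots> = (\<Sum>x\<in>(\<Union>a\<in>F. B a). \<bar>pmf p x - pmf q x\<bar>)"
    using assms by (intro sum.UNION_disjoint[symmetric]) (auto simp: disjoint_family_on_def)
  also have "\<dots> \<le> dTV p q"
    using assms by (intro sum_le_dTV) auto
  finally show ?thesis .
qed

section \<open>Tuples of geometric variables\<close>

text \<open>As an injective image of a product law, the tuple law has point masses that
  factor.\<close>

lemma replicate_pmf_Suc_pair:
  "replicate_pmf (Suc n) p = map_pmf (\<lambda>(x, xs). x # xs) (pair_pmf p (replicate_pmf n p))"
  by (simp add: pair_pmf_def map_bind_pmf)

lemma pmf_replicate_pmf: "pmf (replicate_pmf (length a) p) a = (\<Prod>x\<leftarrow>a. pmf p x)"
proof (induction a)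
  case (Cons b a)
  have "pmf (replicate_pmf (length (b # a)) p) ((\<lambda>(x, xs). x # xs) (b, a)) =
      pmf (pair_pmf p (replicate_pmf (length a) p)) (b, a)"
    unfolding list.size(4) add_Suc_right add_0_right replicate_pmf_Suc_pair
    by (rule pmf_map_inj') (auto simp: inj_def)
  then show ?case
    by (simp add: pmf_pair Cons)
qed simp

lemma pmf_replicate_Geom2:
  assumes "0 \<notin> set a"
  shows "pmf (replicate_pmf (length a) Geom2) a = (1 / 2) ^ sum_list a"
  unfolding pmf_replicate_pmf using assms
  by (induction a) (auto simp: pmf_Geom2 power_add)

text \<open>The generating function of \<open>Geom2\<close>, a geometric series of ratio
  \<open>x / 2\<close>.\<close>

lemma nn_integral_Geom2_power:
  fixes x :: real
  assumes "1 < x" "x < 2"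
  shows "(\<integral>\<^sup>+ a. ennreal (x ^ a) \<partial>Geom2) = ennreal (x / (2 - x))"
proof -
  have "(\<lambda>a. x / 2 * (x / 2) ^ a) sums (x / 2 * (1 / (1 - x / 2)))"
    using assms by (intro sums_mult geometric_sums) auto
  moreover have "x / 2 * (1 / (1 - x / 2)) = x / (2 - x)"
    using assms by (simp add: field_simps)
  ultimately have sums: "(\<lambda>a. (1 / 2) ^ Suc a * x ^ Suc a) sums (x / (2 - x))"
    by (simp add: power_divide)
  have "(\<integral>\<^sup>+ a. ennreal (x ^ a) \<partial>Geom2) = (\<integral>\<^sup>+ a. ennreal (x ^ Suc a) \<partial>geometric_pmf (1 / 2))"
    by (simp add: Geom2_def)
  also have "\<dots> = (\<Sum>a. ennreal ((1 / 2) ^ Suc a * x ^ Suc a))"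
    using assms
    by (simp add: nn_integral_measure_pmf nn_integral_count_space_nat ennreal_mult'[symmetric])
  also have "\<dots> = ennreal (x / (2 - x))"
    using assms sums by (intro suminf_ennreal_eq) auto
  finally show ?thesis .
qed

text \<open>By independence the generating functions multiply.\<close>

lemma nn_integral_replicate_Geom2_power:
  fixes x :: real
  assumes "1 < x" "x < 2"
  shows "(\<integral>\<^sup>+ a. ennreal (x ^ sum_list a) \<partial>replicate_pmf n Geom2) = ennreal ((x / (2 - x)) ^ n)"
proof (induction n)
  case (Suc n)
  have "(\<integral>\<^sup>+ a. ennreal (x ^ sum_list a) \<partial>replicate_pmf (Suc n) Geom2) =
      (\<integral>\<^sup>+ b. (\<integral>\<^sup>+ a. ennreal (x ^ b) * ennreal (x ^ sum_list a) \<partial>replicate_pmf n Geom2) \<partial>Geom2)"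
    using assms by (simp add: power_add ennreal_mult')
  also have "\<dots> = ennreal ((x / (2 - x)) ^ Suc n)"
    using assms
    by (simp add: nn_integral_cmult nn_integral_multc Suc nn_integral_Geom2_power)
       (simp add: ennreal_mult'[symmetric])
  finally show ?case .
qed simp

text \<open>Markov's inequality for \<open>x ^ sum_list a\<close>, which is at least
  \<open>x ^ m\<close> on the event because \<open>x > 1\<close>.\<close>

lemma replicate_Geom2_tail:
  fixes x :: real
  assumes "1 < x" "x < 2"
  shows "measure_pmf.prob (replicate_pmf n Geom2) {a. m \<le> sum_list a} \<le> (x / (2 - x)) ^ n / x ^ m"
proof -
  let ?P = "replicate_pmf n Geom2"
  have "emeasure ?P {a. m \<le> sum_list a} = (\<integral>\<^sup>+ a. indicator {a. m \<le> sum_list a} a \<partial>?P)"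
    by simp
  also have "\<dots> \<le> (\<integral>\<^sup>+ a. ennreal (1 / x ^ m) * ennreal (x ^ sum_list a) \<partial>?P)"
  proof (rule nn_integral_mono)
    fix a :: "nat list"
    have "ennreal 1 \<le> ennreal (1 / x ^ m * x ^ sum_list a)" if "m \<le> sum_list a"
      using assms that by (intro ennreal_leI) (simp add: field_simps power_increasing)
    then show "indicator {a. m \<le> sum_list a} a \<le> ennreal (1 / x ^ m) * ennreal (x ^ sum_list a)"
      using assms by (auto simp: indicator_def ennreal_mult'[symmetric])
  qed
  also have "\<dots> = ennreal (1 / x ^ m) * ennreal ((x / (2 - x)) ^ n)"
    using assms by (subst nn_integral_cmult) (auto simp: nn_integral_replicate_Geom2_power)
  also have "\<dots> = ennreal ((x / (2 - x)) ^ n / x ^ m)"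
    using assms by (simp add: ennreal_mult'[symmetric])
  finally show ?thesis
    using assms by (simp add: measure_pmf.emeasure_eq_measure)
qed

text \<open>
  The logarithm of \<open>x powr (1 + c) * (2 - x)\<close> vanishes at \<open>x = 1\<close>, where its derivative is \<open>c\<close>.
\<close>

lemma Chernoff_parameter_exists:
  fixes c :: real
  assumes "c > 0"
  shows "\<exists>x. 1 < x \<and> x < 2 \<and> x powr (1 + c) * (2 - x) > 1"
proof -
  define f where "f = (\<lambda>x::real. (1 + c) * ln x + ln (2 - x))"
  have "(f has_real_derivative c) (at 1)"
    unfolding f_def by (auto intro!: derivative_eq_intros)
  from DERIV_pos_inc_right[OF this assms]
  obtain d where d: "d > 0" "\<And>h. 0 < h \<Longrightarrow> h < d \<Longrightarrow> f 1 < f (1 + h)"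
    by blast
  \<comment> \<open>Below \<open>d\<close> for the monotonicity of \<open>f\<close>, and below 1 so
    that \<open>1 + h < 2\<close>.\<close>
  define h where "h = min d 1 / 2"
  have h: "0 < h" "h < d" "h < 1"
    using d(1) by (auto simp: h_def)
  have "0 < f (1 + h)"
    using d(2)[of h] h by (simp add: f_def)
  also have "f (1 + h) = ln ((1 + h) powr (1 + c) * (2 - (1 + h)))"
    using h by (simp add: f_def ln_mult ln_powr)
  finally have "(1 + h) powr (1 + c) * (2 - (1 + h)) > 1"
    using h by (subst (asm) ln_gt_zero_iff) auto
  then show ?thesis
    using h by (intro exI[of _ "1 + h"]) auto
qed

lemma replicate_Geom2_tail_exponential:
  fixes c :: real
  assumes "c > 0"
  shows "\<exists>\<delta>>0. \<forall>n m. real m \<ge> (2 + c) * real n \<longrightarrow>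
    measure_pmf.prob (replicate_pmf n Geom2) {a. m \<le> sum_list a} \<le> 2 powr (- \<delta> * real n)"
proof -
  obtain x where x: "1 < x" "x < 2" "x powr (1 + c) * (2 - x) > 1"
    using Chernoff_parameter_exists[OF assms] by blast
  \<comment> \<open>At \<open>m = (2 + c) * n\<close> the Chernoff bound is the \<open>n\<close>-th
    power of \<open>1 / (x powr (1 + c) * (2 - x))\<close>, that is, of
    \<open>2 powr (- \<delta>)\<close>. As \<open>x\<close> is chosen from \<open>c\<close> alone,
    so is \<delta>.\<close>
  define \<delta> where "\<delta> = log 2 (x powr (1 + c) * (2 - x))"
  have "measure_pmf.prob (replicate_pmf n Geom2) {a. m \<le> sum_list a} \<le> 2 powr (- \<delta> * real n)"
    if "real m \<ge> (2 + c) * real n" for n m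
  proof -
    have "x powr ((2 + c) * real n) \<le> x powr real m"
      using that x by (intro powr_mono) auto
    then have "(x / (2 - x)) ^ n / x ^ m \<le> (x / (2 - x)) ^ n / x powr ((2 + c) * real n)"
      using x by (intro divide_left_mono) (auto simp: powr_realpow)
    also have "\<dots> = (x / (2 - x) / x powr (2 + c)) ^ n"
      using x by (simp add: power_divide power_mult_distrib powr_powr[symmetric] powr_realpow)
    also have "x / (2 - x) / x powr (2 + c) = inverse (x powr (1 + c) * (2 - x))"
      using x powr_add[of x 1 "1 + c"] by (simp add: field_simps)
    also have "\<dots> = 2 powr (- \<delta>)"
      using x by (simp add: \<delta>_def powr_minus)
    also have "(2 powr (- \<delta>)) ^ n = 2 powr (- \<delta> * real n)"
      by (simp add: powr_powr flip: powr_realpow)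
    finally show ?thesis
      using replicate_Geom2_tail[OF x(1,2), of n m] by linarith
  qed
  moreover have "\<delta> > 0"
    using x unfolding \<delta>_def by simp
  ultimately show ?thesis
    by blast
qed

section \<open>Comparison of the two laws\<close>

text \<open>The two preimages are compared on the support of \<open>N\<close> only, since the fiber
  description concerns odd numbers.\<close>

lemma pmf_syracuse_valuation:
  assumes "set_pmf N \<subseteq> {k. odd k}" "0 \<notin> set a" "sum_list a < m"
  shows "pmf (map_pmf (syracuse_valuation (length a)) N) a =
    measure_pmf.prob (map_pmf (\<lambda>k. int k mod 2 ^ m) N) (valuation_residues m a)"
proof -
  have "syracuse_valuation (length a) -` {a} \<inter> set_pmf N =
      (\<lambda>k. int k mod 2 ^ m) -` valuation_residues m a \<inter> set_pmf N"
    using assms syracuse_valuation_eq_iff_residue[OF assms(2,3)] by auto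
  then show ?thesis
    by (metis measure_Int_set_pmf measure_map_pmf pmf_map)
qed

text \<open>A ratio of cardinalities: with \<open>s = sum_list a\<close>,
  \<open>2 ^ (m - Suc s)\<close> out of \<open>2 ^ (m - 1)\<close> residues gives exactly
  \<open>(1 / 2) ^ s\<close>.\<close>

lemma prob_uniform_valuation_residues:
  assumes "0 \<notin> set a" "sum_list a < m"
  shows "measure_pmf.prob (pmf_of_set (odd_residues m)) (valuation_residues m a) =
    pmf (replicate_pmf (length a) Geom2) a"
proof -
  have "odd_residues m \<inter> valuation_residues m a = valuation_residues m a"
    by (auto simp: valuation_residues_def)
  moreover have "(2 :: real) ^ (m - 1) = 2 ^ (m - Suc (sum_list a)) * 2 ^ sum_list a"
    using assms(2) by (simp flip: power_add)
  ultimately show ?thesis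
    using assms
    by (simp add: measure_pmf_of_set finite_odd_residues odd_residues_nonempty card_odd_residues
        card_valuation_residues pmf_replicate_Geom2 power_one_over field_simps)
qed

lemma dTV_syracuse_valuation_le:
  assumes "set_pmf N \<subseteq> {k. odd k}"
  shows "dTV (map_pmf (syracuse_valuation n) N) (replicate_pmf n Geom2)
    \<le> 2 * dTV (map_pmf (\<lambda>k. int k mod 2 ^ m) N) (pmf_of_set (odd_residues m))
      + 2 * measure_pmf.prob (replicate_pmf n Geom2) {a. m \<le> sum_list a}"
proof -
  let ?G = "replicate_pmf n Geom2"
  define F where "F = {a. length a = n \<and> 0 \<notin> set a \<and> sum_list a < m}"
  have "finite F"
  proof (rule finite_subset)
    show "F \<subseteq> {a. set a \<subseteq> {..<m} \<and> length a = n}"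
      unfolding F_def using member_le_sum_list by fastforce
  qed (rule finite_lists_length_eq, simp)
  have "(\<Sum>a\<in>F. \<bar>pmf (map_pmf (syracuse_valuation n) N) a - pmf ?G a\<bar>) =
      (\<Sum>a\<in>F. \<bar>measure_pmf.prob (map_pmf (\<lambda>k. int k mod 2 ^ m) N) (valuation_residues m a)
        - measure_pmf.prob (pmf_of_set (odd_residues m)) (valuation_residues m a)\<bar>)"
    using assms
    by (intro sum.cong) (auto simp: F_def pmf_syracuse_valuation prob_uniform_valuation_residues)
  also have "\<dots> \<le> dTV (map_pmf (\<lambda>k. int k mod 2 ^ m) N) (pmf_of_set (odd_residues m))"
    using \<open>finite F\<close>
    by (rule sum_dTV_fibers_le)
       (auto simp: valuation_residues_def finite_odd_residues disjoint_family_on_def F_def)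
  finally have main: "(\<Sum>a\<in>F. \<bar>pmf (map_pmf (syracuse_valuation n) N) a - pmf ?G a\<bar>) \<le> \<dots>" .
  \<comment> \<open>The complement of \<open>F\<close> also contains lists of wrong length or with a
    zero entry; these are null for \<open>?G\<close>, which leaves the large sums.\<close>
  have "0 \<notin> set_pmf Geom2"
    by (simp add: set_pmf_iff pmf_Geom2)
  then have "- F \<inter> set_pmf ?G \<subseteq> {a. m \<le> sum_list a}"
    by (auto simp: F_def set_replicate_pmf lists_eq_set)
  then have "measure_pmf.prob ?G (- F \<inter> set_pmf ?G) \<le> measure_pmf.prob ?G {a. m \<le> sum_list a}"
    by (intro measure_pmf.finite_measure_mono) auto
  then have "measure_pmf.prob ?G (- F) \<le> measure_pmf.prob ?G {a. m \<le> sum_list a}"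
    by (simp add: measure_Int_set_pmf)
  with main dTV_le_finite_part[OF \<open>finite F\<close>, of "map_pmf (syracuse_valuation n) N" ?G]
  show ?thesis
    by linarith
qed

theorem proposition1p9:
  fixes c\<^sub>0 :: real
  assumes "c\<^sub>0 > 0"
  shows "\<exists>c\<^sub>1>0. \<forall>C::real. \<exists>C'::real. \<forall>(n::nat) (n'::nat) (N::nat pmf).
    set_pmf N \<subseteq> {k. odd k} \<longrightarrow>
    real n' \<ge> (2 + c\<^sub>0) * real n \<longrightarrow>
    dTV (map_pmf (\<lambda>k. int k mod 2 ^ n') N) (pmf_of_set (odd_residues n'))
      \<le> C * 2 powr (- real n') \<longrightarrow>
    dTV (map_pmf (syracuse_valuation n) N) (replicate_pmf n Geom2)
      \<le> C' * 2 powr (- c\<^sub>1 * real n)"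
proof -
  obtain \<delta> where "\<delta> > 0" and tail: "\<And>n m. real m \<ge> (2 + c\<^sub>0) * real n \<Longrightarrow>
      measure_pmf.prob (replicate_pmf n Geom2) {a. m \<le> sum_list a} \<le> 2 powr (- \<delta> * real n)"
    using replicate_Geom2_tail_exponential[OF assms] by blast
  \<comment> \<open>The hypothesis contributes \<open>2 powr (- real n')\<close> with
    \<open>n' \<ge> n\<close>, hence decay at rate at least 1, and the tail contributes rate
    \<delta>.\<close>
  define c\<^sub>1 where "c\<^sub>1 = min \<delta> 1"
  \<comment> \<open>\<open>C\<close> may be any real number; its absolute value makes the factor
    nonnegative, so the exponential can be enlarged.\<close>
  have "dTV (map_pmf (syracuse_valuation n) N) (replicate_pmf n Geom2)
      \<le> (2 * \<bar>C\<bar> + 2) * 2 powr (- c\<^sub>1 * real n)"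
    if "set_pmf N \<subseteq> {k. odd k}" and n': "real n' \<ge> (2 + c\<^sub>0) * real n"
      and "dTV (map_pmf (\<lambda>k. int k mod 2 ^ n') N) (pmf_of_set (odd_residues n'))
        \<le> C * 2 powr (- real n')"
    for C n n' N
  proof -
    have "1 * real n \<le> (2 + c\<^sub>0) * real n"
      using assms by (intro mult_right_mono) auto
    moreover have "c\<^sub>1 * real n \<le> 1 * real n" "c\<^sub>1 * real n \<le> \<delta> * real n"
      by (intro mult_right_mono; simp add: c\<^sub>1_def)+
    ultimately have "2 powr (- real n') \<le> 2 powr (- c\<^sub>1 * real n)"
      and "2 powr (- \<delta> * real n) \<le> 2 powr (- c\<^sub>1 * real n)"
      using n' by (auto intro!: powr_mono)
    moreover from this(1) have "C * 2 powr (- real n') \<le> \<bar>C\<bar> * 2 powr (- c\<^sub>1 * real n)"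
      by (intro mult_mono) auto
    ultimately show ?thesis
      using dTV_syracuse_valuation_le[OF that(1), of n n'] that(3) tail[OF n']
      unfolding distrib_right mult.assoc by linarith
  qed
  moreover have "c\<^sub>1 > 0"
    using \<open>\<delta> > 0\<close> by (simp add: c\<^sub>1_def)
  ultimately show ?thesis
    by blast
qed

end
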